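(* Let $G$ be a Garside group with Garside element $\Delta\neq 1$ and coset complex $\mathcal{X}_{\mathcal{D}}$. If $v,w$ are vertices of $\mathcal{X}_{\mathcal{D}}$, $p$ is a vertex on the geodesic from $v$ to $w$ with $v\neq p\neq w$, and $u$ is any vertex of $\mathcal{X}_{\mathcal{D}}$, then there is a strict inequality $$d(u,p)<\max\{d(u,v),d(u,w)\}.$$
   Context: An element $m\neq 1$ of a monoid $M$ is indivisible if $m=ab$ implies $a=1$ or $b=1$. For $m\in M$, $\|m\|$ is the supremum of the lengths of all expressions of $m$ as a product of indivisible elements. $M$ is atomic if it is generated by its indivisible elements and $\|m\|<\infty$ for all $m$. A Garside monoid is an atomic monoid $M$ such that: (1) left and right cancellation laws hold; (2) any two elements admit a least common multiple and a greatest common divisor on both the left and the right; (3) there is an element $\Delta\in M$ (Garside element) whose set of left divisors equals its set of right divisors, this set $\mathcal{D}$ (the simple divisors) is finite, and it generates $M$. A Garside monoid $G^+$ embeds in its group of fractions $G$, called a Garside group. Write $a\le b$ if $a^{-1}b\in G^+$. For $g\in G^+$ let $\mathrm{LF}(g)$ be the left gcd of $g$ and $\Delta$. A word $\mu_1\cdots\mu_k$ in $\mathcal{D}\setminus\{1\}$ is in left greedy normal form if $\mu_i=\mathrm{LF}(\mu_i\cdots\mu_k)$ for all $i$. Every $g\in G$ has a unique Deligne normal form $g=\mu_1\cdots\mu_k\Delta^n$ with $n\in\mathbb{Z}$, $k\ge0$, $\mu_1\cdots\mu_k$ in left greedy normal form and $\mu_1\ne\Delta$. Coset complex $\mathcal{X}_{\mathcal{D}}$: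 its vertices are the cosets $g\langle\Delta\rangle$, $g\in G$; each coset contains exactly one $a\in G^+$ with $\Delta\nleq a$, used as its representative. Two vertices with representatives $a,b$ are joined by an edge iff $b=a\mu$ or $a=b\mu$ for some $\mu\in\mathcal{D}\setminus\{1,\Delta\}$, and $\mathcal{X}_{\mathcal{D}}$ is the flag complex of this graph. $G$ acts on it by left multiplication on cosets. Geodesics: for vertices represented by $v,w\in G$, let the Deligne normal form of $v^{-1}w$ be $b_1\cdots b_n\Delta^k$. The geodesic from $v$ to $w$ is the edge path through the vertices $v\langle\Delta\rangle, vb_1\langle\Delta\rangle,\dots,vb_1\cdots b_n\langle\Delta\rangle=w\langle\Delta\rangle$. The (nonsymmetric) distance is $d(v,w)=\|b_1\cdots b_n\|$. Both are independent of the chosen coset representatives. *)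

theory Defs
  imports "HOL-Algebra.Algebra" "HOL-Library.Extended_Nat"
begin

section \<open>Garside monoids\<close>

definition mprod :: "('a, 'b) monoid_scheme \<Rightarrow> 'a list \<Rightarrow> 'a" where
  "mprod M xs = foldr (\<otimes>\<^bsub>M\<^esub>) xs \<one>\<^bsub>M\<^esub>"

definition indivisible :: "('a, 'b) monoid_scheme \<Rightarrow> 'a \<Rightarrow> bool" where
  "indivisible M m \<longleftrightarrow> m \<in> carrier M \<and> m \<noteq> \<one>\<^bsub>M\<^esub> \<and>
     (\<forall>a\<in>carrier M. \<forall>b\<in>carrier M. m = a \<otimes>\<^bsub>M\<^esub> b \<longrightarrow> a = \<one>\<^bsub>M\<^esub> \<or> b = \<one>\<^bsub>M\<^esub>)"

definition mon_norm :: "('a, 'b) monoid_scheme \<Rightarrow> 'a \<Rightarrow> enat" where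
  "mon_norm M m =
     (SUP xs \<in> {xs. set xs \<subseteq> Collect (indivisible M) \<and> mprod M xs = m}. enat (length xs))"

definition generates_monoid :: "('a, 'b) monoid_scheme \<Rightarrow> 'a set \<Rightarrow> bool" where
  "generates_monoid M S \<longleftrightarrow> S \<subseteq> carrier M \<and>
     (\<forall>m\<in>carrier M. \<exists>xs. set xs \<subseteq> S \<and> mprod M xs = m)"

definition atomic_monoid :: "('a, 'b) monoid_scheme \<Rightarrow> bool" where
  "atomic_monoid M \<longleftrightarrow> monoid M \<and> generates_monoid M (Collect (indivisible M)) \<and>
     (\<forall>m\<in>carrier M. mon_norm M m < \<infinity>)"

text \<open>
  In a noncommutative monoid the library relation \<open>divides\<close> (and with it \<open>gcdof\<close>, \<open>lcmof\<close>)
  is left divisibility: \<open>a\<close> divides \<open>b\<close> iff \<open>b = a \<otimes> c\<close> for some \<open>c\<close>. The right-handed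
  notions are the same relations taken in the opposite monoid.
\<close>

definition opposite :: "('a, 'b) monoid_scheme \<Rightarrow> ('a, 'b) monoid_scheme" where
  "opposite M = M\<lparr>mult := (\<lambda>x y. y \<otimes>\<^bsub>M\<^esub> x)\<rparr>"

definition has_gcds_lcms :: "('a, 'b) monoid_scheme \<Rightarrow> bool" where
  "has_gcds_lcms M \<longleftrightarrow> (\<forall>a\<in>carrier M. \<forall>b\<in>carrier M.
     (\<exists>m\<in>carrier M. m lcmof\<^bsub>M\<^esub> a b) \<and> (\<exists>d\<in>carrier M. d gcdof\<^bsub>M\<^esub> a b))"

definition simple_divisors :: "('a, 'b) monoid_scheme \<Rightarrow> 'a \<Rightarrow> 'a set" where
  "simple_divisors M \<Delta> = {x \<in> carrier M. x divides\<^bsub>M\<^esub> \<Delta>}"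

definition garside_element :: "('a, 'b) monoid_scheme \<Rightarrow> 'a \<Rightarrow> bool" where
  "garside_element M \<Delta> \<longleftrightarrow> \<Delta> \<in> carrier M \<and>
     simple_divisors M \<Delta> = simple_divisors (opposite M) \<Delta> \<and>
     finite (simple_divisors M \<Delta>) \<and> generates_monoid M (simple_divisors M \<Delta>)"

locale garside_monoid =
  fixes M :: "('a, 'b) monoid_scheme" and \<Delta> :: 'a
  assumes atomic: "atomic_monoid M"
    and left_cancel: "\<lbrakk>a \<in> carrier M; x \<in> carrier M; y \<in> carrier M;
          a \<otimes>\<^bsub>M\<^esub> x = a \<otimes>\<^bsub>M\<^esub> y\<rbrakk> \<Longrightarrow> x = y"
    and right_cancel: "\<lbrakk>a \<in> carrier M; x \<in> carrier M; y \<in> carrier M;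
          x \<otimes>\<^bsub>M\<^esub> a = y \<otimes>\<^bsub>M\<^esub> a\<rbrakk> \<Longrightarrow> x = y"
    and left_lattice: "has_gcds_lcms M"
    and right_lattice: "has_gcds_lcms (opposite M)"
    and garside: "garside_element M \<Delta>"

section \<open>Garside groups\<close>

abbreviation submon :: "('a, 'b) monoid_scheme \<Rightarrow> 'a set \<Rightarrow> ('a, 'b) monoid_scheme" where
  "submon G P \<equiv> G\<lparr>carrier := P\<rparr>"

text \<open>
  The Garside monoid \<open>G\<^sup>+\<close> is identified with its image \<open>P\<close> in its group of fractions \<open>G\<close>;
  that \<open>G\<close> is the group of fractions of \<open>P\<close> means that every element of \<open>G\<close> is a left
  fraction of elements of \<open>P\<close>.
\<close>

locale garside_group = group G for G :: "('a, 'b) monoid_scheme" (structure) +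
  fixes P :: "'a set" and \<Delta> :: 'a
  assumes positive_submonoid: "submonoid P G"
    and positive_garside: "garside_monoid (submon G P) \<Delta>"
    and fractions: "g \<in> carrier G \<Longrightarrow> \<exists>a\<in>P. \<exists>b\<in>P. g = inv a \<otimes> b"

definition garside_le :: "('a, 'b) monoid_scheme \<Rightarrow> 'a set \<Rightarrow> 'a \<Rightarrow> 'a \<Rightarrow> bool" where
  "garside_le G P a b \<longleftrightarrow> inv\<^bsub>G\<^esub> a \<otimes>\<^bsub>G\<^esub> b \<in> P"

definition LF :: "('a, 'b) monoid_scheme \<Rightarrow> 'a \<Rightarrow> 'a \<Rightarrow> 'a" where
  "LF M \<Delta> g = (THE d. d \<in> carrier M \<and> d gcdof\<^bsub>M\<^esub> g \<Delta>)"

definition left_greedy :: "('a, 'b) monoid_scheme \<Rightarrow> 'a \<Rightarrow> 'a list \<Rightarrow> bool" where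
  "left_greedy M \<Delta> ms \<longleftrightarrow> set ms \<subseteq> simple_divisors M \<Delta> - {\<one>\<^bsub>M\<^esub>} \<and>
     (\<forall>i<length ms. ms ! i = LF M \<Delta> (mprod M (drop i ms)))"

definition is_deligne_nf ::
  "('a, 'b) monoid_scheme \<Rightarrow> 'a set \<Rightarrow> 'a \<Rightarrow> 'a \<Rightarrow> 'a list \<Rightarrow> int \<Rightarrow> bool" where
  "is_deligne_nf G P \<Delta> g ms n \<longleftrightarrow> left_greedy (submon G P) \<Delta> ms \<and>
     (ms \<noteq> [] \<longrightarrow> hd ms \<noteq> \<Delta>) \<and> g = mprod G ms \<otimes>\<^bsub>G\<^esub> (\<Delta> [^]\<^bsub>G\<^esub> n)"

text \<open>The word \<open>\<mu>\<^sub>1, \<dots>, \<mu>\<^sub>k\<close> of the Deligne normal form, without the power of \<open>\<Delta>\<close>.\<close>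

definition deligne_word :: "('a, 'b) monoid_scheme \<Rightarrow> 'a set \<Rightarrow> 'a \<Rightarrow> 'a \<Rightarrow> 'a list" where
  "deligne_word G P \<Delta> g = (THE ms. \<exists>n. is_deligne_nf G P \<Delta> g ms n)"

section \<open>The coset complex\<close>

definition Delta_coset :: "('a, 'b) monoid_scheme \<Rightarrow> 'a \<Rightarrow> 'a \<Rightarrow> 'a set" where
  "Delta_coset G \<Delta> g = g <#\<^bsub>G\<^esub> generate G {\<Delta>}"

definition coset_vertices :: "('a, 'b) monoid_scheme \<Rightarrow> 'a \<Rightarrow> 'a set set" where
  "coset_vertices G \<Delta> = Delta_coset G \<Delta> ` carrier G"

definition coset_rep :: "('a, 'b) monoid_scheme \<Rightarrow> 'a set \<Rightarrow> 'a \<Rightarrow> 'a set \<Rightarrow> 'a" where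
  "coset_rep G P \<Delta> V = (THE a. a \<in> V \<and> a \<in> P \<and> \<not> garside_le G P \<Delta> a)"

definition coset_adj ::
  "('a, 'b) monoid_scheme \<Rightarrow> 'a set \<Rightarrow> 'a \<Rightarrow> 'a set \<Rightarrow> 'a set \<Rightarrow> bool" where
  "coset_adj G P \<Delta> V W \<longleftrightarrow>
     (\<exists>\<mu> \<in> simple_divisors (submon G P) \<Delta> - {\<one>\<^bsub>G\<^esub>, \<Delta>}.
        coset_rep G P \<Delta> W = coset_rep G P \<Delta> V \<otimes>\<^bsub>G\<^esub> \<mu> \<or>
        coset_rep G P \<Delta> V = coset_rep G P \<Delta> W \<otimes>\<^bsub>G\<^esub> \<mu>)"

text \<open>Abstract simplicial complexes are represented by their sets of (nonempty, finite) simplices.\<close>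

definition flag_complex :: "'v set \<Rightarrow> ('v \<Rightarrow> 'v \<Rightarrow> bool) \<Rightarrow> 'v set set" where
  "flag_complex V E = {\<sigma>. \<sigma> \<noteq> {} \<and> finite \<sigma> \<and> \<sigma> \<subseteq> V \<and> (\<forall>x\<in>\<sigma>. \<forall>y\<in>\<sigma>. x \<noteq> y \<longrightarrow> E x y)}"

definition vertices :: "'v set set \<Rightarrow> 'v set" where
  "vertices K = {x. {x} \<in> K}"

definition coset_complex :: "('a, 'b) monoid_scheme \<Rightarrow> 'a set \<Rightarrow> 'a \<Rightarrow> 'a set set set" where
  "coset_complex G P \<Delta> = flag_complex (coset_vertices G \<Delta>) (coset_adj G P \<Delta>)"

text \<open>
  Geodesics and distances of vertices are computed with the distinguished representatives;
  the result is the same for any other choice of representatives.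
\<close>

definition geodesic ::
  "('a, 'b) monoid_scheme \<Rightarrow> 'a set \<Rightarrow> 'a \<Rightarrow> 'a set \<Rightarrow> 'a set \<Rightarrow> 'a set list" where
  "geodesic G P \<Delta> V W =
     (let v = coset_rep G P \<Delta> V; w = coset_rep G P \<Delta> W;
          bs = deligne_word G P \<Delta> (inv\<^bsub>G\<^esub> v \<otimes>\<^bsub>G\<^esub> w)
      in map (\<lambda>i. Delta_coset G \<Delta> (v \<otimes>\<^bsub>G\<^esub> mprod G (take i bs))) [0..<Suc (length bs)])"

definition coset_dist ::
  "('a, 'b) monoid_scheme \<Rightarrow> 'a set \<Rightarrow> 'a \<Rightarrow> 'a set \<Rightarrow> 'a set \<Rightarrow> enat" where
  "coset_dist G P \<Delta> V W =
     (let v = coset_rep G P \<Delta> V; w = coset_rep G P \<Delta> W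
      in mon_norm (submon G P) (mprod G (deligne_word G P \<Delta> (inv\<^bsub>G\<^esub> v \<otimes>\<^bsub>G\<^esub> w))))"

end

theory Submission
  imports Defs
begin

text \<open>
  Every vertex is \<open>u a \<langle>\<Delta>\<rangle>\<close> for a unique positive \<open>a\<close> with \<open>\<Delta> \<nleq> a\<close>, and
  its distance from \<open>u\<close> is \<open>\<parallel>a\<parallel>\<close>. Seen from \<open>u\<close>, the vertices \<open>v\<close> and \<open>w\<close> are therefore given
  by two positive elements \<open>a\<close> and \<open>b\<close>. Let \<open>c\<close> be their left gcd and write \<open>a = c x\<close>, \<open>b = c y\<close>,
  so that \<open>x\<close> and \<open>y\<close> have no common left divisor other than \<open>1\<close>. Up to a power of \<open>\<Delta>\<close>, which
  only twists the word by a power of conjugation by \<open>\<Delta>\<close>, the difference \<open>v\<^sup>-\<^sup>1 w\<close> is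
  \<open>x\<^sup>-\<^sup>1 y\<close>.

  The point is that the normal form of such a fraction is explicit. If \<open>x = x\<^sub>1 \<dots> x\<^sub>m\<close> and
  \<open>y = y\<^sub>1 \<dots> y\<^sub>n\<close> are greedy, then replacing each \<open>x\<^sub>i\<^sup>-\<^sup>1\<close> by
  \<open>(x\<^sub>i\<^sup>-\<^sup>1 \<Delta>) \<Delta>\<^sup>-\<^sup>1\<close> and moving all \<open>\<Delta>\<^sup>-\<^sup>1\<close> to the right turns
  \<open>x\<^sub>m\<^sup>-\<^sup>1 \<dots> x\<^sub>1\<^sup>-\<^sup>1 y\<^sub>1 \<dots> y\<^sub>n\<close> into a word that is again greedy. Among the
  complements this is the greediness of \<open>x\<close> read backwards; at the corner it says precisely that
  \<open>x\<^sub>1\<close> and \<open>y\<^sub>1\<close> are coprime. This is the lemma \<open>nf_coprime_fraction\<close>. Consequently the geodesic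
  from \<open>v\<close> to \<open>w\<close> first removes the factors of \<open>x\<close> from the right, arriving at \<open>u c\<close>, and then
  appends the factors of \<open>y\<close>: each of its vertices is \<open>u z \<langle>\<Delta>\<rangle>\<close> with \<open>z\<close> a left divisor of \<open>a\<close>
  or of \<open>b\<close> (lemma \<open>nf_fraction\<close>).

  Such a \<open>z\<close> is not divisible by \<open>\<Delta>\<close> either, so \<open>d(u,p) = \<parallel>z\<parallel>\<close>. At an interior vertex the
  divisor is proper, and the norm strictly increases along proper divisibility because it is
  superadditive (lemma \<open>norm_strict_mono\<close>). Hence \<open>\<parallel>z\<parallel>\<close> is smaller than \<open>\<parallel>a\<parallel> = d(u,v)\<close> or
  than \<open>\<parallel>b\<parallel> = d(u,w)\<close>.
\<close>

context garside_group
begin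

section \<open>Divisibility and norm in the positive monoid\<close>

abbreviation le (infix "\<preceq>" 50) where "a \<preceq> b \<equiv> garside_le G P a b"
abbreviation "M \<equiv> submon G P"

lemma P_carrier [simp]: "a \<in> P \<Longrightarrow> a \<in> carrier G"
  using submonoid.subset[OF positive_submonoid] by blast
lemma P_one [simp]: "\<one> \<in> P"
  using submonoid.one_closed[OF positive_submonoid] .
lemma P_mult [simp]: "a \<in> P \<Longrightarrow> b \<in> P \<Longrightarrow> a \<otimes> b \<in> P"
  using submonoid.m_closed[OF positive_submonoid] .

lemma inv_mult_cancel [simp]:
  assumes "a \<in> carrier G" "b \<in> carrier G"
  shows "inv a \<otimes> (a \<otimes> b) = b" "a \<otimes> (inv a \<otimes> b) = b"
  using assms by (simp_all add: m_assoc[symmetric])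

lemma le_iff:
  assumes "a \<in> carrier G" "b \<in> carrier G"
  shows "a \<preceq> b \<longleftrightarrow> (\<exists>c\<in>P. b = a \<otimes> c)"
proof
  assume "a \<preceq> b"
  then show "\<exists>c\<in>P. b = a \<otimes> c"
    using assms unfolding garside_le_def by (intro bexI[of _ "inv a \<otimes> b"]) auto
next
  assume "\<exists>c\<in>P. b = a \<otimes> c"
  then show "a \<preceq> b" using assms by (auto simp: garside_le_def)
qed

lemma divides_iff:
  assumes "a \<in> P" "b \<in> P"
  shows "a divides\<^bsub>M\<^esub> b \<longleftrightarrow> a \<preceq> b"
  using assms by (simp add: le_iff factor_def)

lemma le_refl [simp]: "a \<in> carrier G \<Longrightarrow> a \<preceq> a"
  by (simp add: garside_le_def)

lemma le_mult [simp]: "a \<in> carrier G \<Longrightarrow> b \<in> P \<Longrightarrow> a \<preceq> a \<otimes> b"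
  by (simp add: garside_le_def)

lemma le_trans:
  assumes "a \<preceq> b" "b \<preceq> c" "a \<in> carrier G" "b \<in> carrier G" "c \<in> carrier G"
  shows "a \<preceq> c"
proof -
  obtain s t where "s \<in> P" "t \<in> P" "b = a \<otimes> s" "c = b \<otimes> t"
    using assms by (auto simp: le_iff)
  then show ?thesis using assms by (simp add: m_assoc)
qed

lemma le_mult_left [simp]:
  assumes "a \<in> carrier G" "b \<in> carrier G" "c \<in> carrier G"
  shows "c \<otimes> a \<preceq> c \<otimes> b \<longleftrightarrow> a \<preceq> b"
  using assms by (simp add: garside_le_def inv_mult_group m_assoc)

lemma mprod_submon [simp]: "mprod M = mprod G"
  by (simp add: mprod_def fun_eq_iff)

lemma mprod_Nil [simp]: "mprod G [] = \<one>"
  by (simp add: mprod_def)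
lemma mprod_Cons [simp]: "mprod G (x # xs) = x \<otimes> mprod G xs"
  by (simp add: mprod_def)

lemma mprod_P [simp]: "set xs \<subseteq> P \<Longrightarrow> mprod G xs \<in> P"
  by (induction xs) auto

lemma mprod_append [simp]:
  "set xs \<subseteq> P \<Longrightarrow> set ys \<subseteq> P \<Longrightarrow> mprod G (xs @ ys) = mprod G xs \<otimes> mprod G ys"
  by (induction xs) (auto simp: m_assoc)

lemma mprod_take_le: "set xs \<subseteq> P \<Longrightarrow> mprod G (take i xs) \<preceq> mprod G xs"
  by (metis append_take_drop_id le_mult mprod_append mprod_P P_carrier set_drop_subset
      set_take_subset subset_trans)

abbreviation norm where "norm a \<equiv> mon_norm M a"

abbreviation "Ind \<equiv> Collect (indivisible M)"

lemma Ind_P: "Ind \<subseteq> P" by (auto simp: indivisible_def)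

text \<open>A bounded nonempty set of lengths contains its supremum; longest words can thus be concatenated.\<close>

lemma norm_attained:
  assumes "a \<in> P"
  obtains xs where "set xs \<subseteq> Ind" "mprod G xs = a" "norm a = enat (length xs)"
proof -
  have at: "atomic_monoid M"
    using garside_monoid.atomic[OF positive_garside] .
  obtain N where N: "norm a = enat N"
    using at assms by (auto simp: atomic_monoid_def less_infinityE)
  let ?W = "{xs. set xs \<subseteq> Ind \<and> mprod G xs = a}"
  have le: "length xs \<le> N" if "xs \<in> ?W" for xs
  proof -
    have "enat (length xs) \<le> norm a"
      unfolding mon_norm_def using that by (intro SUP_upper) auto
    then show ?thesis using N by simp
  qed
  obtain xs0 where xs0: "xs0 \<in> ?W"
    using at assms by (auto simp: atomic_monoid_def generates_monoid_def)
  have "\<exists>xs\<in>?W. length xs = N"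
  proof (rule ccontr)
    assume no: "\<not> ?thesis"
    have *: "length xs < N" if "xs \<in> ?W" for xs
      using le[OF that] no that le_neq_implies_less by blast
    have "norm a \<le> enat (N - 1)"
      unfolding mon_norm_def mprod_submon using * by (intro SUP_least) fastforce
    then show False using N *[OF xs0] by simp
  qed
  then show ?thesis using that N by auto
qed

lemma norm_superadditive:
  assumes "a \<in> P" "b \<in> P"
  shows "norm a + norm b \<le> norm (a \<otimes> b)"
proof -
  obtain xs where xs: "set xs \<subseteq> Ind" "mprod G xs = a" "norm a = enat (length xs)"
    using norm_attained assms by blast
  obtain ys where ys: "set ys \<subseteq> Ind" "mprod G ys = b" "norm b = enat (length ys)"
    using norm_attained assms by blast
  have "mprod G (xs @ ys) = a \<otimes> b"
    using xs ys Ind_P by (subst mprod_append) auto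
  then have "enat (length (xs @ ys)) \<le> norm (a \<otimes> b)"
    unfolding mon_norm_def using xs ys by (intro SUP_upper) auto
  then show ?thesis using xs ys by simp
qed

text \<open>A nontrivial factor contributes at least one letter to a longest word of the product.\<close>

lemma norm_strict_mono:
  assumes "a \<in> P" "b \<in> P"
  shows "b \<noteq> \<one> \<Longrightarrow> norm a < norm (a \<otimes> b)" "a \<noteq> \<one> \<Longrightarrow> norm b < norm (a \<otimes> b)"
proof -
  obtain xs where xs: "mprod G xs = a" "norm a = enat (length xs)"
    using norm_attained assms by blast
  obtain ys where ys: "mprod G ys = b" "norm b = enat (length ys)"
    using norm_attained assms by blast
  note le = norm_superadditive[OF assms, unfolded xs ys plus_enat_simps]
  show "norm a < norm (a \<otimes> b)" if "b \<noteq> \<one>"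
    using that xs ys by (cases ys; intro less_le_trans[OF _ le]) auto
  show "norm b < norm (a \<otimes> b)" if "a \<noteq> \<one>"
    using that xs ys by (cases xs; intro less_le_trans[OF _ le]) auto
qed

lemma norm_less:
  assumes "a \<preceq> b" "a \<noteq> b" "a \<in> P" "b \<in> P"
  shows "norm a < norm b"
proof -
  obtain c where "c \<in> P" "b = a \<otimes> c" using assms by (auto simp: le_iff)
  moreover have "c \<noteq> \<one>" using calculation assms by auto
  ultimately show ?thesis using norm_strict_mono assms by auto
qed

text \<open>
  Two different elements dividing each other would each have norm smaller than the other. In
  particular \<open>1\<close> is the only unit of the positive monoid, and gcds are unique.
\<close>

lemma le_antisym:
  assumes "a \<preceq> b" "b \<preceq> a" "a \<in> P" "b \<in> P"
  shows "a = b"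
  using norm_less[of a b] norm_less[of b a] assms by force

lemma le_one: "a \<in> P \<Longrightarrow> a \<preceq> \<one> \<Longrightarrow> a = \<one>"
  by (rule le_antisym) (auto simp: garside_le_def)

lemma mult_eq_one: "a \<in> P \<Longrightarrow> b \<in> P \<Longrightarrow> a \<otimes> b = \<one> \<Longrightarrow> a = \<one>"
  using le_one le_mult by (metis P_carrier)

section \<open>Conjugation by \<open>\<Delta>\<close>\<close>

lemma Delta_P [simp]: "\<Delta> \<in> P"
  using garside_monoid.garside[OF positive_garside] by (simp add: garside_element_def)

abbreviation "D \<equiv> simple_divisors M \<Delta>"

lemma simple_iff: "s \<in> D \<longleftrightarrow> s \<in> P \<and> s \<preceq> \<Delta>"
  by (auto simp: simple_divisors_def divides_iff)

lemma simple_iff_right: "s \<in> D \<longleftrightarrow> s \<in> P \<and> (\<exists>t\<in>P. \<Delta> = t \<otimes> s)"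
proof -
  have "D = simple_divisors (opposite M) \<Delta>"
    using garside_monoid.garside[OF positive_garside] by (simp add: garside_element_def)
  then show ?thesis
    by (auto simp: simple_divisors_def opposite_def factor_def)
qed

lemma simple_word:
  assumes "a \<in> P" obtains xs where "set xs \<subseteq> D" "mprod G xs = a"
  using garside_monoid.garside[OF positive_garside] assms
  by (auto simp: garside_element_def generates_monoid_def)

lemma D_P: "s \<in> D \<Longrightarrow> s \<in> P" by (simp add: simple_iff)

definition Delta_conj :: "int \<Rightarrow> 'a \<Rightarrow> 'a" where
  "Delta_conj k a = \<Delta> [^] (- k) \<otimes> (a \<otimes> \<Delta> [^] k)"

lemma Delta_conj_mult:
  "a \<in> carrier G \<Longrightarrow> b \<in> carrier G \<Longrightarrow>
    Delta_conj k (a \<otimes> b) = Delta_conj k a \<otimes> Delta_conj k b"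
  by (simp add: Delta_conj_def m_assoc int_pow_neg)

lemma Delta_conj_one [simp]: "Delta_conj k \<one> = \<one>"
  by (simp add: Delta_conj_def int_pow_neg)

lemma Delta_conj_conj:
  "a \<in> carrier G \<Longrightarrow> Delta_conj k (Delta_conj l a) = Delta_conj (k + l) a"
  by (simp add: Delta_conj_def m_assoc int_pow_mult [symmetric] add.commute)
     (simp add: m_assoc [symmetric] int_pow_mult [symmetric])

lemma Delta_conj_0 [simp]: "a \<in> carrier G \<Longrightarrow> Delta_conj 0 a = a"
  by (simp add: Delta_conj_def)

lemma Delta_conj_closed [simp]: "a \<in> carrier G \<Longrightarrow> Delta_conj k a \<in> carrier G"
  by (simp add: Delta_conj_def)

lemma Delta_conj_Delta [simp]: "Delta_conj k \<Delta> = \<Delta>"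
proof -
  have "\<Delta> \<otimes> \<Delta> [^] k = \<Delta> [^] k \<otimes> \<Delta>"
    using int_pow_mult[of \<Delta> 1 k] int_pow_mult[of \<Delta> k 1] by (simp add: add.commute)
  then show ?thesis by (simp add: Delta_conj_def int_pow_neg)
qed

text \<open>
  Taking complements twice conjugates by \<open>\<Delta>\<close>: if \<open>\<Delta> = s t = t r\<close>, then
  \<open>s \<Delta> = s t r = \<Delta> r\<close>. The second factorisation exists because the right divisor \<open>t\<close> of \<open>\<Delta>\<close> is
  also a left divisor.
\<close>

lemma Delta_conj_simple:
  assumes "s \<in> D"
  shows "Delta_conj 1 s \<in> P" "Delta_conj (- 1) s \<in> P"
proof -
  obtain t where t: "t \<in> P" "\<Delta> = s \<otimes> t" using assms by (auto simp: simple_iff le_iff)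
  then have "t \<in> D" using D_P[OF assms] unfolding simple_iff_right by blast
  then obtain r where r: "r \<in> P" "\<Delta> = t \<otimes> r" by (auto simp: simple_iff le_iff)
  have "s \<otimes> \<Delta> = \<Delta> \<otimes> r" using assms D_P t r by (metis m_assoc P_carrier)
  then show "Delta_conj 1 s \<in> P"
    unfolding Delta_conj_def using r(1) by (simp add: int_pow_neg)
next
  obtain t where t: "t \<in> P" "\<Delta> = t \<otimes> s" using assms by (auto simp: simple_iff_right)
  then have "t \<in> D" using D_P[OF assms] unfolding simple_iff by (metis P_carrier le_mult)
  then obtain r where r: "r \<in> P" "\<Delta> = r \<otimes> t" by (auto simp: simple_iff_right)
  have "\<Delta> \<otimes> s = r \<otimes> \<Delta>" using assms D_P t r by (metis m_assoc P_carrier)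
  then have "\<Delta> \<otimes> (s \<otimes> inv \<Delta>) = r"
    using r(1) D_P[OF assms] Delta_P
    by (metis P_carrier inv_closed m_assoc r_inv r_one)
  then show "Delta_conj (- 1) s \<in> P"
    unfolding Delta_conj_def using r(1) by (simp add: int_pow_neg)
qed

lemma Delta_conj_mprod:
  "set xs \<subseteq> P \<Longrightarrow> mprod G (map (Delta_conj k) xs) = Delta_conj k (mprod G xs)"
  by (induction xs) (auto simp: Delta_conj_mult)

text \<open>
  Conjugation by \<open>\<Delta>\<close> is an automorphism of the positive monoid, since the simple divisors
  generate it. By the commutation rules that follow, powers of \<open>\<Delta>\<close> can be moved through
  positive elements.
\<close>

lemma Delta_conj_P [simp]:
  assumes "a \<in> P" shows "Delta_conj k a \<in> P"
proof -
  have step: "Delta_conj 1 b \<in> P \<and> Delta_conj (- 1) b \<in> P" if b: "b \<in> P" for b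
  proof -
    obtain xs where xs: "set xs \<subseteq> D" "mprod G xs = b" using simple_word b by blast
    have sub: "set xs \<subseteq> P" using xs D_P by blast
    have "mprod G (map (Delta_conj 1) xs) \<in> P" "mprod G (map (Delta_conj (-1)) xs) \<in> P"
      using xs Delta_conj_simple by (force intro!: mprod_P)+
    then show ?thesis using sub xs by (simp add: Delta_conj_mprod)
  qed
  show ?thesis
  proof (induction k rule: int_induct[where k = 0])
    case base then show ?case using assms by simp
  next
    case (step1 i)
    then show ?case using step[of "Delta_conj i a"] assms
      by (simp add: Delta_conj_conj add.commute)
  next
    case (step2 i)
    then show ?case using step[of "Delta_conj i a"] assms
      by (simp add: Delta_conj_conj)
  qed
qed

lemma Delta_conj_le [simp]:
  assumes "a \<in> P" "b \<in> P"
  shows "Delta_conj k a \<preceq> Delta_conj k b \<longleftrightarrow> a \<preceq> b"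
proof -
  have imp: "Delta_conj k a \<preceq> Delta_conj k b" if "a \<preceq> b" "a \<in> P" "b \<in> P" for a b k
    using that by (auto simp: le_iff Delta_conj_mult)
  show ?thesis
    using imp[of a b k] imp[of "Delta_conj k a" "Delta_conj k b" "- k"] assms
    by (auto simp: Delta_conj_conj)
qed

lemma mult_Delta_pow:
  "a \<in> carrier G \<Longrightarrow> a \<otimes> \<Delta> [^] (k :: int) = \<Delta> [^] k \<otimes> Delta_conj k a"
  by (simp add: Delta_conj_def int_pow_neg)

lemma Delta_pow_mult:
  "a \<in> carrier G \<Longrightarrow> \<Delta> [^] (k :: int) \<otimes> a = Delta_conj (- k) a \<otimes> \<Delta> [^] k"
  using mult_Delta_pow[of "Delta_conj (- k) a" k] by (simp add: Delta_conj_conj)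

lemma Delta_le_mult:
  assumes "a \<in> P" "b \<in> P" "\<Delta> \<preceq> b"
  shows "\<Delta> \<preceq> a \<otimes> b"
proof -
  obtain c where c: "c \<in> P" "b = \<Delta> \<otimes> c" using assms by (auto simp: le_iff)
  then have "a \<otimes> b = \<Delta> \<otimes> (Delta_conj 1 a \<otimes> c)"
    using assms mult_Delta_pow[of a 1] by (simp add: m_assoc[symmetric])
  then show ?thesis using c assms by simp
qed

section \<open>Greedy normal forms\<close>

lemma gcdof_iff:
  assumes "d \<in> P" "a \<in> P" "b \<in> P"
  shows "d gcdof\<^bsub>M\<^esub> a b \<longleftrightarrow>
    d \<preceq> a \<and> d \<preceq> b \<and> (\<forall>e\<in>P. e \<preceq> a \<longrightarrow> e \<preceq> b \<longrightarrow> e \<preceq> d)"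
  using assms by (auto simp: isgcd_def divides_iff)

lemma ex_gcd:
  assumes "a \<in> P" "b \<in> P"
  obtains d where "d \<in> P" "d gcdof\<^bsub>M\<^esub> a b"
  using garside_monoid.left_lattice[OF positive_garside] assms
  by (auto simp: has_gcds_lcms_def)

lemma gcd_unique:
  assumes "d gcdof\<^bsub>M\<^esub> a b" "d' gcdof\<^bsub>M\<^esub> a b" "d \<in> P" "d' \<in> P" "a \<in> P" "b \<in> P"
  shows "d = d'"
  using assms by (auto simp: gcdof_iff intro: le_antisym)

lemma LF_eq_iff:
  assumes "g \<in> P"
  shows "LF M \<Delta> g = d \<longleftrightarrow> d \<in> P \<and> d gcdof\<^bsub>M\<^esub> g \<Delta>"
proof -
  obtain d' where d': "d' \<in> P" "d' gcdof\<^bsub>M\<^esub> g \<Delta>" using ex_gcd assms Delta_P by blast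
  have "LF M \<Delta> g = d'"
    unfolding LF_def using d' gcd_unique assms by (intro the_equality) auto
  then show ?thesis using d' gcd_unique[of d g \<Delta> d'] assms by auto
qed

abbreviation greedy where "greedy xs \<equiv> left_greedy M \<Delta> xs"

lemma greedy_Nil [simp]: "greedy []" by (simp add: left_greedy_def)

lemma greedy_P: "greedy xs \<Longrightarrow> set xs \<subseteq> P"
  using D_P by (auto simp: left_greedy_def)

lemma greedy_Cons:
  "greedy (s # xs) \<longleftrightarrow>
    s \<in> P \<and> s \<noteq> \<one> \<and> s gcdof\<^bsub>M\<^esub> (s \<otimes> mprod G xs) \<Delta> \<and> greedy xs"
proof -
  have "greedy (s # xs) \<longleftrightarrow>
      s \<in> D - {\<one>} \<and> s = LF M \<Delta> (s \<otimes> mprod G xs) \<and> greedy xs"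
    by (auto simp: left_greedy_def All_less_Suc2)
  also have "\<dots> \<longleftrightarrow>
      s \<in> P \<and> s \<noteq> \<one> \<and> s gcdof\<^bsub>M\<^esub> (s \<otimes> mprod G xs) \<Delta> \<and> greedy xs"
    using LF_eq_iff[of "s \<otimes> mprod G xs" s] greedy_P
    by (auto simp: simple_iff gcdof_iff)
  finally show ?thesis .
qed

text \<open>
  For a prefix: shortening the product can only remove common divisors with \<open>\<Delta>\<close>, and its first
  letter still is one.
\<close>

lemma greedy_appendD:
  "greedy (xs @ ys) \<Longrightarrow> greedy xs \<and> greedy ys"
proof (induction xs)
  case (Cons s xs)
  then have *: "s \<in> P" "s \<noteq> \<one>" "s gcdof\<^bsub>M\<^esub> (s \<otimes> mprod G (xs @ ys)) \<Delta>"
      "greedy (xs @ ys)" "greedy xs" "greedy ys"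
    by (auto simp: greedy_Cons)
  have P: "mprod G xs \<in> P" "mprod G ys \<in> P" "mprod G (xs @ ys) = mprod G xs \<otimes> mprod G ys"
    using * greedy_P by auto
  have "s \<otimes> mprod G xs \<preceq> s \<otimes> mprod G (xs @ ys)" using * P by simp
  then have "s gcdof\<^bsub>M\<^esub> (s \<otimes> mprod G xs) \<Delta>"
    using * P le_trans[of _ "s \<otimes> mprod G xs" "s \<otimes> mprod G (xs @ ys)"] by (auto simp: gcdof_iff)
  then show ?case using * by (simp add: greedy_Cons)
qed simp

lemma greedy_map_Delta_conj:
  "greedy xs \<Longrightarrow> greedy (map (Delta_conj k) xs)"
proof (induction xs)
  case (Cons s xs)
  then have *: "s \<in> P" "s \<noteq> \<one>" "s gcdof\<^bsub>M\<^esub> (s \<otimes> mprod G xs) \<Delta>" "greedy xs"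
    by (auto simp: greedy_Cons)
  let ?g = "s \<otimes> mprod G xs"
  have P: "set xs \<subseteq> P" "mprod G xs \<in> P" using * greedy_P by auto
  have "Delta_conj k s gcdof\<^bsub>M\<^esub> (Delta_conj k ?g) \<Delta>"
  proof (subst gcdof_iff; (intro conjI ballI impI)?)
    show "Delta_conj k s \<preceq> Delta_conj k ?g" using * P by simp
    show "Delta_conj k s \<preceq> \<Delta>"
      using * P Delta_conj_le[of s \<Delta> k] by (simp add: gcdof_iff)
    fix e assume e: "e \<in> P" "e \<preceq> Delta_conj k ?g" "e \<preceq> \<Delta>"
    let ?e = "Delta_conj (- k) e"
    have eq: "e = Delta_conj k ?e" using e by (simp add: Delta_conj_conj)
    have "?e \<preceq> ?g" using e * P Delta_conj_le[of ?e ?g k] eq by simp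
    moreover have "?e \<preceq> \<Delta>" using e Delta_conj_le[of ?e \<Delta> k] eq by simp
    ultimately have "?e \<preceq> s" using * P e by (simp add: gcdof_iff)
    then show "e \<preceq> Delta_conj k s" using * e Delta_conj_le[of ?e s k] eq by simp
  qed (use * P in auto)
  moreover have "Delta_conj k s \<noteq> \<one>"
  proof
    assume "Delta_conj k s = \<one>"
    then have "Delta_conj (- k) (Delta_conj k s) = \<one>" by simp
    then show False using * by (simp add: Delta_conj_conj)
  qed
  ultimately show ?case
    using * P Cons.IH by (simp add: greedy_Cons Delta_conj_mult Delta_conj_mprod)
qed simp

lemma ex_simple_factor:
  assumes "a \<in> P" "a \<noteq> \<one>"
  obtains s where "s \<in> P" "s \<noteq> \<one>" "s \<preceq> \<Delta>" "s \<preceq> a"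
proof -
  have "\<exists>s\<in>D - {\<one>}. s \<preceq> mprod G xs" if "set xs \<subseteq> D" "mprod G xs \<noteq> \<one>" for xs
    using that
  proof (induction xs)
    case (Cons x xs)
    then have "x \<in> D" "x \<in> P" "mprod G xs \<in> P" using D_P by (auto intro!: mprod_P)
    then show ?case using Cons by (cases "x = \<one>") (auto intro!: bexI[of _ x])
  qed simp
  then show ?thesis using that assms simple_word[OF assms(1)] by (metis DiffE simple_iff singletonI)
qed

text \<open>Splitting off the gcd with \<open>\<Delta>\<close> lowers the norm, as this gcd is nontrivial for \<open>a \<noteq> 1\<close>.\<close>

lemma ex_greedy:
  assumes "a \<in> P" shows "\<exists>xs. greedy xs \<and> mprod G xs = a"
  using assms
proof (induction "norm a" arbitrary: a rule: less_induct)
  case (less a)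
  show ?case
  proof (cases "a = \<one>")
    case True then show ?thesis by (intro exI[of _ "[]"]) simp
  next
    case False
    obtain d where d: "d \<in> P" "d gcdof\<^bsub>M\<^esub> a \<Delta>" using ex_gcd less.prems Delta_P by blast
    then obtain c where c: "c \<in> P" "a = d \<otimes> c" using less.prems by (auto simp: gcdof_iff le_iff)
    obtain s where s: "s \<in> P" "s \<noteq> \<one>" "s \<preceq> \<Delta>" "s \<preceq> a"
      using ex_simple_factor[OF less.prems False] .
    have "s \<preceq> d" using s d less.prems by (simp add: gcdof_iff)
    then have "d \<noteq> \<one>" using s le_one by blast
    then have "norm c < norm a" using norm_strict_mono(2)[OF d(1) c(1)] c(2) by simp
    then obtain xs where "greedy xs" "mprod G xs = c"
      using less.hyps[of c] c(1) by blast
    then have "greedy (d # xs) \<and> mprod G (d # xs) = a"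
      using c d \<open>d \<noteq> \<one>\<close> by (simp add: greedy_Cons)
    then show ?thesis by blast
  qed
qed

lemma mprod_greedy_Cons_neq_one:
  assumes "greedy (x # xs)"
  shows "mprod G (x # xs) \<noteq> \<one>"
proof -
  have "x \<in> P" "x \<noteq> \<one>" "greedy xs" using assms by (simp_all add: greedy_Cons)
  then show ?thesis using mult_eq_one[of x "mprod G xs"] greedy_P by auto
qed

text \<open>The first letter is determined by the product, and can be cancelled.\<close>

lemma greedy_unique:
  "greedy xs \<Longrightarrow> greedy ys \<Longrightarrow> mprod G xs = mprod G ys \<Longrightarrow> xs = ys"
proof (induction xs arbitrary: ys)
  case Nil
  then show ?case using mprod_greedy_Cons_neq_one by (cases ys) force+
next
  case (Cons x xs)
  then obtain y ys' where ys: "ys = y # ys'"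
    using mprod_greedy_Cons_neq_one[OF Cons.prems(1)] by (cases ys) auto
  have x: "x \<in> P" "x gcdof\<^bsub>M\<^esub> (mprod G ys) \<Delta>" "greedy xs" "mprod G xs \<in> P"
    using Cons.prems greedy_P by (auto simp: greedy_Cons)
  have y: "y \<in> P" "y gcdof\<^bsub>M\<^esub> (mprod G ys) \<Delta>" "greedy ys'" "mprod G ys' \<in> P" "mprod G ys \<in> P"
    using Cons.prems greedy_P by (auto simp: greedy_Cons ys)
  have "x = y" using gcd_unique x y Delta_P by blast
  then have "mprod G xs = mprod G ys'" using Cons.prems(3) x y by (simp add: ys)
  then show ?case using Cons.IH[OF x(3) y(3)] \<open>x = y\<close> ys by simp
qed

text \<open>
  This turns the condition on the first letter of a Deligne normal form into one on its positive
  part, which is easier to transport. For the empty word it needs that \<open>\<Delta>\<close> does not divide \<open>1\<close>.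
\<close>

lemma hd_greedy_eq_Delta_iff:
  assumes "greedy xs" "\<Delta> \<noteq> \<one>"
  shows "(xs \<noteq> [] \<longrightarrow> hd xs \<noteq> \<Delta>) \<longleftrightarrow> \<not> \<Delta> \<preceq> mprod G xs"
proof (cases xs)
  case Nil
  then show ?thesis using le_one[of \<Delta>] assms by auto
next
  case (Cons x ys)
  have "x \<in> P" "x gcdof\<^bsub>M\<^esub> (mprod G xs) \<Delta>" "mprod G xs \<in> P"
    using assms greedy_P by (auto simp: Cons greedy_Cons)
  then show ?thesis using Cons by (auto simp: gcdof_iff intro: le_antisym)
qed

abbreviation "nf \<equiv> is_deligne_nf G P \<Delta>"

text \<open>
  If the exponents differed, the side with the smaller one would have a positive part of the
  form \<open>b \<Delta> \<Delta>\<^sup>k\<close>, which \<open>\<Delta>\<close> divides on the left as well.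
\<close>

lemma Delta_free_unique:
  assumes "a \<in> P" "b \<in> P" "\<not> \<Delta> \<preceq> a" "\<not> \<Delta> \<preceq> b"
    and eq: "a \<otimes> \<Delta> [^] (m :: int) = b \<otimes> \<Delta> [^] (n :: int)"
  shows "a = b"
proof -
  have aux: "\<not> m < n" if "a \<in> P" "b \<in> P" "\<not> \<Delta> \<preceq> a"
    "a \<otimes> \<Delta> [^] (m :: int) = b \<otimes> \<Delta> [^] (n :: int)" for a b m n
  proof
    assume "m < n"
    then obtain k where k: "n = 1 + int k + m" by (metis add.commute zless_iff_Suc_zadd of_nat_Suc)
    have pow: "\<Delta> [^] (k :: nat) \<in> P" by (induction k) auto
    have "\<Delta> [^] (1 + int k) = \<Delta> \<otimes> \<Delta> [^] k"
      by (simp add: int_pow_mult int_pow_int)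
    then have "b \<otimes> \<Delta> [^] n = (b \<otimes> (\<Delta> \<otimes> \<Delta> [^] k)) \<otimes> \<Delta> [^] m"
      using that by (simp add: k int_pow_mult m_assoc)
    then have "a = b \<otimes> (\<Delta> \<otimes> \<Delta> [^] k)"
      using that by simp
    moreover have "\<Delta> \<preceq> b \<otimes> (\<Delta> \<otimes> \<Delta> [^] k)"
      using that(2) pow by (intro Delta_le_mult[OF that(2)] le_mult) auto
    ultimately show False using that by simp
  qed
  have "m = n" using aux[of a b m n] aux[of b a n m] assms by auto
  then show ?thesis using assms by simp
qed

lemma deligne_word_eq:
  assumes "nf g xs n" "\<Delta> \<noteq> \<one>"
  shows "deligne_word G P \<Delta> g = xs"
  unfolding deligne_word_def
proof (rule the_equality)
  show "\<exists>n. nf g xs n" using assms by blast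
  fix ys assume "\<exists>m. nf g ys m"
  then obtain m where m: "nf g ys m" by blast
  have "mprod G ys = mprod G xs"
    using Delta_free_unique[of "mprod G ys" "mprod G xs" m n] assms m greedy_P
      hd_greedy_eq_Delta_iff[of xs] hd_greedy_eq_Delta_iff[of ys]
    unfolding is_deligne_nf_def by auto
  then show "ys = xs" using greedy_unique assms m by (auto simp: is_deligne_nf_def)
qed

lemma ex_nf:
  assumes "a \<in> P" "\<not> \<Delta> \<preceq> a" "\<Delta> \<noteq> \<one>"
  shows "\<exists>xs. nf (a \<otimes> \<Delta> [^] (n :: int)) xs n \<and> mprod G xs = a"
proof -
  obtain xs where xs: "greedy xs" "mprod G xs = a" using ex_greedy assms by blast
  have "xs \<noteq> [] \<longrightarrow> hd xs \<noteq> \<Delta>"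
    using hd_greedy_eq_Delta_iff[OF xs(1) assms(3)] assms(2) xs(2) by blast
  then have "nf (a \<otimes> \<Delta> [^] n) xs n"
    using xs unfolding is_deligne_nf_def by blast
  then show ?thesis using xs(2) by blast
qed

text \<open>
  Changing the representatives of the two endpoints by powers of \<open>\<Delta>\<close> multiplies their difference
  on both sides by such powers. This only twists the word of the normal form.
\<close>

lemma nf_Delta_pow:
  assumes "nf g xs n" "\<Delta> \<noteq> \<one>"
  shows "nf (\<Delta> [^] (- k) \<otimes> (g \<otimes> \<Delta> [^] l)) (map (Delta_conj k) xs) (n - k + l)"
proof -
  have g: "greedy xs" "set xs \<subseteq> P" "mprod G xs \<in> P" "g = mprod G xs \<otimes> \<Delta> [^] n"
    using assms greedy_P[of xs] mprod_P[of xs] unfolding is_deligne_nf_def by blast+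
  have "\<not> \<Delta> \<preceq> mprod G xs"
    using hd_greedy_eq_Delta_iff[of xs] assms unfolding is_deligne_nf_def by blast
  then have "\<not> \<Delta> \<preceq> mprod G (map (Delta_conj k) xs)"
    using Delta_conj_le[of \<Delta> "mprod G xs" k] g by (simp add: Delta_conj_mprod)
  moreover have "\<Delta> [^] (- k) \<otimes> (g \<otimes> \<Delta> [^] l)
      = Delta_conj k (mprod G xs) \<otimes> \<Delta> [^] (n - k + l)"
  proof -
    have "\<Delta> [^] (- k) \<otimes> (g \<otimes> \<Delta> [^] l)
        = (\<Delta> [^] (- k) \<otimes> mprod G xs) \<otimes> (\<Delta> [^] n \<otimes> \<Delta> [^] l)"
      using g by (simp add: m_assoc)
    also have "\<dots> = Delta_conj k (mprod G xs) \<otimes> \<Delta> [^] (- k) \<otimes> (\<Delta> [^] n \<otimes> \<Delta> [^] l)"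
      using g Delta_pow_mult[of "mprod G xs" "- k"] by simp
    also have "\<dots> = Delta_conj k (mprod G xs) \<otimes> \<Delta> [^] (- k + (n + l))"
      using g int_pow_mult[of \<Delta> n l] int_pow_mult[of \<Delta> "- k" "n + l"] by (simp add: m_assoc)
    also have "- k + (n + l) = n - k + l" by simp
    finally show ?thesis .
  qed
  moreover have "greedy (map (Delta_conj k) xs)" using g greedy_map_Delta_conj by blast
  ultimately show ?thesis
    using hd_greedy_eq_Delta_iff[of "map (Delta_conj k) xs"] assms(2) g(2)
    unfolding is_deligne_nf_def Delta_conj_mprod[OF g(2)] by blast
qed

section \<open>The normal form of a fraction\<close>

definition left_coprime :: "'a \<Rightarrow> 'a \<Rightarrow> bool" where
  "left_coprime a b \<longleftrightarrow> (\<forall>e\<in>P. e \<preceq> a \<longrightarrow> e \<preceq> b \<longrightarrow> e = \<one>)"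

text \<open>
  The greediness of \<open>s\<close> in \<open>s b\<close> is a statement about the complement \<open>t\<close> of \<open>s\<close>: common divisors of
  \<open>s b\<close> and \<open>\<Delta> = s t\<close> above \<open>s\<close> correspond, after cancelling \<open>s\<close>, to common divisors of \<open>b\<close> and \<open>t\<close>.
\<close>

lemma gcdof_Delta_iff_coprime:
  assumes "s \<in> P" "t \<in> P" "s \<otimes> t = \<Delta>" "b \<in> P"
  shows "s gcdof\<^bsub>M\<^esub> (s \<otimes> b) \<Delta> \<longleftrightarrow> left_coprime b t"
proof
  assume L: "s gcdof\<^bsub>M\<^esub> (s \<otimes> b) \<Delta>"
  show "left_coprime b t"
    unfolding left_coprime_def
  proof (intro ballI impI)
    fix e assume e: "e \<in> P" "e \<preceq> b" "e \<preceq> t"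
    then have "s \<otimes> e \<preceq> s \<otimes> b" "s \<otimes> e \<preceq> s \<otimes> t" using assms(1,2,4) by simp_all
    then have "s \<otimes> e \<preceq> s \<otimes> \<one>" using L assms e by (auto simp: gcdof_iff)
    then show "e = \<one>" using assms e le_one by (subst (asm) le_mult_left) auto
  qed
next
  assume R: "left_coprime b t"
  obtain d where d: "d \<in> P" "d gcdof\<^bsub>M\<^esub> (s \<otimes> b) \<Delta>"
    using ex_gcd[of "s \<otimes> b" \<Delta>] assms by auto
  have "s \<preceq> \<Delta>" using assms(1-3) le_mult[of s t] by simp
  then have "s \<preceq> d" using d assms by (simp add: gcdof_iff)
  then obtain e where e: "e \<in> P" "d = s \<otimes> e" using d assms by (auto simp: le_iff)
  have "s \<otimes> e \<preceq> s \<otimes> b" "s \<otimes> e \<preceq> s \<otimes> t" using d e assms by (auto simp: gcdof_iff)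
  then have "e = \<one>" using R e assms(1,2,4) by (simp add: left_coprime_def)
  then show "s gcdof\<^bsub>M\<^esub> (s \<otimes> b) \<Delta>" using d e assms by simp
qed

lemma left_coprime_Delta_conj:
  assumes "left_coprime a b" "a \<in> P" "b \<in> P"
  shows "left_coprime (Delta_conj k a) (Delta_conj k b)"
  unfolding left_coprime_def
proof (intro ballI impI)
  fix e assume e: "e \<in> P" "e \<preceq> Delta_conj k a" "e \<preceq> Delta_conj k b"
  have eq: "e = Delta_conj k (Delta_conj (- k) e)" using e by (simp add: Delta_conj_conj)
  have "Delta_conj (- k) e = \<one>"
    using assms e Delta_conj_le[of "Delta_conj (- k) e" a k]
      Delta_conj_le[of "Delta_conj (- k) e" b k] eq
    by (simp add: left_coprime_def)
  then show "e = \<one>" using eq by simp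
qed

text \<open>
  The induction appends a last factor \<open>s\<close> to the denominator \<open>x\<close>, which prepends the complement
  \<open>t\<close> of \<open>s\<close> to the normal form: from \<open>s t = \<Delta>\<close> one gets
  \<open>s\<^sup>-\<^sup>1 b \<Delta>\<^sup>n = t (\<Delta>\<^sup>-\<^sup>1 b \<Delta>) \<Delta>\<^sup>n\<^sup>-\<^sup>1\<close>. The new word is greedy iff \<open>s\<close> and the old
  first letter are coprime, and so the induction has to carry along what the first letter is:
  the complement of the last factor of \<open>x\<close>, or the first letter of \<open>y\<close> when \<open>x = 1\<close>. The last clause
  records the path from \<open>x\<close> to \<open>y\<close>; its first step now leads from \<open>x s\<close> to \<open>x s t = x \<Delta>\<close>.
\<close>

lemma nf_coprime_fraction:
  assumes "\<Delta> \<noteq> \<one>" "greedy xs" "greedy ys" "left_coprime (mprod G xs) (mprod G ys)"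
    and "\<not> \<Delta> \<preceq> mprod G xs" "\<not> \<Delta> \<preceq> mprod G ys"
  shows "\<exists>ms n. nf (inv (mprod G xs) \<otimes> mprod G ys) ms n \<and>
    (if xs = [] then ms = ys else ms \<noteq> [] \<and> last xs \<otimes> hd ms = \<Delta>) \<and>
    (\<forall>i. \<exists>k::int. \<exists>z\<in>P. (z \<preceq> mprod G xs \<or> z \<preceq> mprod G ys) \<and>
      mprod G xs \<otimes> mprod G (take i ms) = z \<otimes> \<Delta> [^] k)"
  using assms
proof (induction xs rule: rev_induct)
  case Nil
  have ys: "set ys \<subseteq> P" "\<And>i. set (take i ys) \<subseteq> P" "mprod G ys \<in> P" "\<And>i. mprod G (take i ys) \<in> P"
    using Nil greedy_P set_take_subset by (force, force, force, meson mprod_P order_trans greedy_P set_take_subset Nil.prems)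
  have "nf (inv (mprod G []) \<otimes> mprod G ys) ys 0"
    using Nil hd_greedy_eq_Delta_iff[of ys] ys by (auto simp: is_deligne_nf_def)
  moreover have "\<exists>k::int. \<exists>z\<in>P. (z \<preceq> mprod G [] \<or> z \<preceq> mprod G ys) \<and>
      mprod G [] \<otimes> mprod G (take i ys) = z \<otimes> \<Delta> [^] k" for i
    using ys mprod_take_le[of ys i]
    by (intro exI[of _ "0::int"] bexI[of _ "mprod G (take i ys)"]) auto
  ultimately show ?case by auto
next
  case (snoc s xs)
  define x where "x = mprod G xs"
  define y where "y = mprod G ys"
  have gr: "greedy xs" "greedy [s]" using greedy_appendD snoc.prems by blast+
  have s: "s \<in> P" "s \<noteq> \<one>" "s \<preceq> \<Delta>"
    using gr by (auto simp: greedy_Cons gcdof_iff)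
  have xy: "x \<in> P" "y \<in> P" "set xs \<subseteq> P" using gr snoc.prems greedy_P by (auto simp: x_def y_def)
  have xs_eq: "mprod G (xs @ [s]) = x \<otimes> s" using xy s by (simp add: x_def)
  have "x \<preceq> x \<otimes> s" using xy s by simp
  have cop: "left_coprime x y"
    using snoc.prems(4) xs_eq \<open>x \<preceq> x \<otimes> s\<close> xy s le_trans[of _ x "x \<otimes> s"]
    by (auto simp: left_coprime_def y_def)
  have Dx: "\<not> \<Delta> \<preceq> x"
    using snoc.prems(5) xs_eq \<open>x \<preceq> x \<otimes> s\<close> xy s le_trans[of \<Delta> x "x \<otimes> s"] by auto
  obtain ms n where ms: "nf (inv x \<otimes> y) ms n"
      "if xs = [] then ms = ys else ms \<noteq> [] \<and> last xs \<otimes> hd ms = \<Delta>"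
    and pre: "\<And>i. \<exists>k::int. \<exists>z\<in>P. (z \<preceq> x \<or> z \<preceq> y) \<and> x \<otimes> mprod G (take i ms) = z \<otimes> \<Delta> [^] k"
    using snoc.IH[OF snoc.prems(1) gr(1) snoc.prems(3) cop[unfolded x_def y_def]
      Dx[unfolded x_def] snoc.prems(6)] unfolding x_def y_def by blast
  define b where "b = mprod G ms"
  have b: "b \<in> P" "set ms \<subseteq> P" "greedy ms" "inv x \<otimes> y = b \<otimes> \<Delta> [^] n"
    using ms greedy_P by (auto simp: is_deligne_nf_def b_def)
  obtain t where t: "t \<in> P" "s \<otimes> t = \<Delta>" using s by (auto simp: le_iff)
  have tD: "t = inv s \<otimes> \<Delta>" using t s by auto
  \<comment> \<open>The complement of \<open>t\<close> is not \<open>s\<close> but its conjugate, matching the twist of the old word.\<close>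
  have comp: "t \<otimes> Delta_conj 1 s = \<Delta>"
    using s by (simp add: tD Delta_conj_def m_assoc int_pow_neg)
  have "left_coprime b s"
  proof (cases "xs = []")
    case True
    then have "x = \<one>" "b = y" using ms by (auto simp: x_def b_def y_def)
    then show ?thesis using snoc.prems(4) xs_eq s by (auto simp: left_coprime_def y_def)
  next
    case False
    then obtain xs0 r where xs0: "xs = xs0 @ [r]" by (metis rev_exhaust)
    from False ms obtain q ms' where q: "ms = q # ms'" "r \<otimes> q = \<Delta>"
      by (cases ms) (auto simp: xs0)
    \<comment> \<open>Greediness of the adjacent factors \<open>r, s\<close> of the denominator says that \<open>s\<close> is coprime to
      the complement \<open>q\<close> of \<open>r\<close>. As \<open>s\<close> is simple, its common divisors with all of \<open>b\<close> already
      divide the first letter \<open>q\<close> of \<open>b\<close>.\<close>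
    have "greedy [r, s]" using snoc.prems(2) greedy_appendD[of xs0 "[r, s]"] by (simp add: xs0)
    then have r: "r \<in> P" "r gcdof\<^bsub>M\<^esub> (r \<otimes> s) \<Delta>" using s by (auto simp: greedy_Cons)
    have q': "q \<in> P" "q gcdof\<^bsub>M\<^esub> b \<Delta>" using b by (auto simp: q greedy_Cons b_def)
    have "left_coprime s q" using gcdof_Delta_iff_coprime r q q' s by blast
    moreover have "e \<preceq> q" if "e \<in> P" "e \<preceq> b" "e \<preceq> s" for e
      using that q' b s le_trans[of e s \<Delta>] by (auto simp: gcdof_iff)
    ultimately show ?thesis by (auto simp: left_coprime_def)
  qed
  then have "t gcdof\<^bsub>M\<^esub> (t \<otimes> Delta_conj 1 b) \<Delta>"
    using gcdof_Delta_iff_coprime[OF t(1) _ comp] left_coprime_Delta_conj b s by simp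
  moreover have "t \<noteq> \<one>"
  proof
    assume "t = \<one>"
    then have "s = \<Delta>" using t s by simp
    then show False using snoc.prems(5) xs_eq Delta_le_mult[of x \<Delta>] xy by simp
  qed
  ultimately have gr': "greedy (t # map (Delta_conj 1) ms)"
    using t b greedy_map_Delta_conj by (simp add: greedy_Cons Delta_conj_mprod b_def)
  have "t \<noteq> \<Delta>"
  proof
    assume "t = \<Delta>"
    then have "s \<otimes> \<Delta> = \<one> \<otimes> \<Delta>" using t by simp
    then show False using s by (metis P_carrier Delta_P r_cancel one_closed)
  qed
  have shift: "t \<otimes> (Delta_conj 1 a \<otimes> \<Delta> [^] j) = inv s \<otimes> (a \<otimes> \<Delta> [^] (j + 1))"
    if "a \<in> P" for a and j :: int
    using that s by (simp add: tD Delta_conj_def m_assoc int_pow_neg add.commute[of j] int_pow_mult)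
  have "nf (inv (mprod G (xs @ [s])) \<otimes> mprod G ys) (t # map (Delta_conj 1) ms) (n - 1)"
    using gr' \<open>t \<noteq> \<Delta>\<close> shift[of b "n - 1"] b xy s t
    by (simp add: is_deligne_nf_def xs_eq y_def[symmetric] inv_mult_group m_assoc
        Delta_conj_mprod b_def[symmetric])
  moreover have "\<exists>k::int. \<exists>z\<in>P. (z \<preceq> x \<otimes> s \<or> z \<preceq> y) \<and>
      x \<otimes> s \<otimes> mprod G (take i (t # map (Delta_conj 1) ms)) = z \<otimes> \<Delta> [^] k" for i
  proof (cases i)
    case 0
    then show ?thesis using xy s by (intro exI[of _ "0::int"] bexI[of _ "x \<otimes> s"]) auto
  next
    case (Suc j)
    obtain k :: int and z where z: "z \<in> P" "z \<preceq> x \<or> z \<preceq> y"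
        "x \<otimes> mprod G (take j ms) = z \<otimes> \<Delta> [^] k"
      using pre by blast
    have tk: "set (take j ms) \<subseteq> P" using b set_take_subset by fast
    let ?a = "mprod G (take j ms)"
    have a: "?a \<in> P" using tk by simp
    have "x \<otimes> s \<otimes> mprod G (take i (t # map (Delta_conj 1) ms)) = x \<otimes> (s \<otimes> (t \<otimes> (Delta_conj 1 ?a \<otimes> \<Delta> [^] (0::int))))"
      using tk a xy s t by (simp add: Suc take_map Delta_conj_mprod m_assoc)
    also have "\<dots> = x \<otimes> ?a \<otimes> \<Delta> [^] (1::int)"
      using shift[OF a, of 0] a xy s by (simp add: m_assoc)
    also have "\<dots> = z \<otimes> \<Delta> [^] (k + 1)"
      using z by (simp add: m_assoc int_pow_mult)
    finally have "x \<otimes> s \<otimes> mprod G (take i (t # map (Delta_conj 1) ms)) = z \<otimes> \<Delta> [^] (k + 1)" .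
    moreover have "z \<preceq> x \<otimes> s \<or> z \<preceq> y"
      using z \<open>x \<preceq> x \<otimes> s\<close> xy s le_trans[of z x "x \<otimes> s"] by auto
    ultimately show ?thesis using z by blast
  qed
  moreover have "last (xs @ [s]) \<otimes> hd (t # map (Delta_conj 1) ms) = \<Delta>" using t by simp
  ultimately show ?case unfolding xs_eq y_def[symmetric] by auto
qed

text \<open>
  Cancelling the left gcd of \<open>a\<close> and \<open>b\<close> reduces to the coprime case: the fraction is unchanged and
  the path is translated. As \<open>\<Delta>\<close> divides neither \<open>a\<close> nor \<open>b\<close>, it divides neither cofactor.
\<close>

lemma nf_fraction:
  assumes "\<Delta> \<noteq> \<one>" "a \<in> P" "b \<in> P" "\<not> \<Delta> \<preceq> a" "\<not> \<Delta> \<preceq> b"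
  shows "\<exists>ms n. nf (inv a \<otimes> b) ms n \<and>
    (\<forall>i. \<exists>k::int. \<exists>z\<in>P. (z \<preceq> a \<or> z \<preceq> b) \<and> a \<otimes> mprod G (take i ms) = z \<otimes> \<Delta> [^] k)"
proof -
  obtain c where c: "c \<in> P" "c gcdof\<^bsub>M\<^esub> a b" using ex_gcd assms by blast
  then obtain x y where xy: "x \<in> P" "y \<in> P" "a = c \<otimes> x" "b = c \<otimes> y"
    using assms by (auto simp: gcdof_iff le_iff)
  have cop: "left_coprime x y"
    unfolding left_coprime_def
  proof (intro ballI impI)
    fix e assume e: "e \<in> P" "e \<preceq> x" "e \<preceq> y"
    then have "c \<otimes> e \<preceq> a" "c \<otimes> e \<preceq> b" using xy c by simp_all
    then have "c \<otimes> e \<preceq> c \<otimes> \<one>" using e c assms(2,3) by (simp add: gcdof_iff)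
    then show "e = \<one>" using e c le_one by (subst (asm) le_mult_left) auto
  qed
  obtain xs ys where w: "greedy xs" "mprod G xs = x" "greedy ys" "mprod G ys = y"
    using ex_greedy xy by blast
  have "\<not> \<Delta> \<preceq> x" "\<not> \<Delta> \<preceq> y" using assms xy c Delta_le_mult by blast+
  then obtain ms n where ms: "nf (inv x \<otimes> y) ms n"
    and path: "\<And>i. \<exists>k::int. \<exists>z\<in>P. (z \<preceq> x \<or> z \<preceq> y) \<and> x \<otimes> mprod G (take i ms) = z \<otimes> \<Delta> [^] k"
    using nf_coprime_fraction[of xs ys] cop w assms(1) by blast
  have "inv a \<otimes> b = inv x \<otimes> y" using xy c by (simp add: inv_mult_group m_assoc)
  moreover have "\<exists>k::int. \<exists>z\<in>P. (z \<preceq> a \<or> z \<preceq> b) \<and> a \<otimes> mprod G (take i ms) = z \<otimes> \<Delta> [^] k" for i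
  proof -
    obtain k :: int and z where z: "z \<in> P" "z \<preceq> x \<or> z \<preceq> y"
        "x \<otimes> mprod G (take i ms) = z \<otimes> \<Delta> [^] k"
      using path by blast
    have "set (take i ms) \<subseteq> P"
      using ms greedy_P set_take_subset by (fastforce simp: is_deligne_nf_def)
    then have "mprod G (take i ms) \<in> P" by simp
    then have "a \<otimes> mprod G (take i ms) = c \<otimes> z \<otimes> \<Delta> [^] k"
      using z xy c by (simp add: m_assoc)
    moreover have "c \<otimes> z \<preceq> a \<or> c \<otimes> z \<preceq> b" using z xy c by auto
    moreover have "c \<otimes> z \<in> P" using z c by simp
    ultimately show ?thesis by blast
  qed
  ultimately show ?thesis using ms by auto
qed

section \<open>Cosets, geodesics and distances\<close>

text \<open>
  The elements of this shape are closed under products since powers of \<open>\<Delta>\<close> can be moved to the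
  right, and they contain the inverse of each simple \<open>s\<close>, namely \<open>t \<Delta>\<^sup>-\<^sup>1\<close> with \<open>s t = \<Delta>\<close>.
\<close>

lemma ex_positive_Delta_pow:
  assumes "g \<in> carrier G"
  shows "\<exists>a\<in>P. \<exists>n::int. g = a \<otimes> \<Delta> [^] n"
proof -
  have mult: "\<exists>a\<in>P. \<exists>n::int. g \<otimes> h = a \<otimes> \<Delta> [^] n"
    if g: "\<exists>a\<in>P. \<exists>n::int. g = a \<otimes> \<Delta> [^] n" and h: "\<exists>a\<in>P. \<exists>n::int. h = a \<otimes> \<Delta> [^] n"
    for g h
  proof -
    obtain a m where a: "a \<in> P" "g = a \<otimes> \<Delta> [^] (m :: int)" using g by blast
    obtain b n where b: "b \<in> P" "h = b \<otimes> \<Delta> [^] (n :: int)" using h by blast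
    have "g \<otimes> h = a \<otimes> (\<Delta> [^] m \<otimes> b) \<otimes> \<Delta> [^] n" using a b by (simp add: m_assoc)
    also have "\<dots> = a \<otimes> Delta_conj (- m) b \<otimes> \<Delta> [^] (m + n)"
      using a b Delta_pow_mult[of b m] by (simp add: int_pow_mult m_assoc)
    finally have "g \<otimes> h = a \<otimes> Delta_conj (- m) b \<otimes> \<Delta> [^] (m + n)" .
    moreover have "a \<otimes> Delta_conj (- m) b \<in> P" using a b by simp
    ultimately show ?thesis by blast
  qed
  have inv_word: "\<exists>a\<in>P. \<exists>n::int. inv (mprod G xs) = a \<otimes> \<Delta> [^] n" if "set xs \<subseteq> D" for xs
    using that
  proof (induction xs)
    case Nil
    show ?case by (intro bexI[of _ \<one>] exI[of _ "0::int"]) auto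
  next
    case (Cons s xs)
    have s: "s \<in> P" and xs: "mprod G xs \<in> P" using Cons.prems D_P by (auto intro!: mprod_P)
    obtain t where t: "t \<in> P" "\<Delta> = s \<otimes> t" using Cons.prems by (auto simp: simple_iff le_iff)
    have "inv \<Delta> = inv t \<otimes> inv s" using s t(1) unfolding t(2) by (simp add: inv_mult_group)
    then have "inv s = t \<otimes> \<Delta> [^] (- 1 :: int)" using s t(1) by (simp add: int_pow_neg)
    then have "\<exists>a\<in>P. \<exists>n::int. inv s = a \<otimes> \<Delta> [^] n" using t(1) by blast
    moreover have "\<exists>a\<in>P. \<exists>n::int. inv (mprod G xs) = a \<otimes> \<Delta> [^] n"
      using Cons by (intro Cons.IH) simp
    moreover have "inv (mprod G (s # xs)) = inv (mprod G xs) \<otimes> inv s"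
      using s xs by (simp add: inv_mult_group)
    ultimately show ?case using mult by presburger
  qed
  obtain a b where ab: "a \<in> P" "b \<in> P" "g = inv a \<otimes> b" using fractions[OF assms] by blast
  have "b = b \<otimes> \<Delta> [^] (0 :: int)" using ab by simp
  then have "\<exists>c\<in>P. \<exists>n::int. b = c \<otimes> \<Delta> [^] n" using ab(2) by blast
  moreover obtain xs where "set xs \<subseteq> D" "mprod G xs = a" using simple_word[OF ab(1)] .
  then have "\<exists>c\<in>P. \<exists>n::int. inv a = c \<otimes> \<Delta> [^] n" using inv_word by blast
  ultimately show ?thesis using mult unfolding ab(3) by presburger
qed

text \<open>Moving a factor \<open>\<Delta>\<close> of \<open>a\<close> into the power lowers the norm, so this process ends.\<close>

lemma ex_Delta_free:
  assumes "g \<in> carrier G" "\<Delta> \<noteq> \<one>"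
  obtains a n where "a \<in> P" "\<not> \<Delta> \<preceq> a" "g = a \<otimes> \<Delta> [^] (n :: int)"
proof -
  have strip: "\<exists>b\<in>P. \<exists>m::int. \<not> \<Delta> \<preceq> b \<and> a \<otimes> \<Delta> [^] n = b \<otimes> \<Delta> [^] m"
    if "a \<in> P" for a and n :: int
    using that
  proof (induction "norm a" arbitrary: a n rule: less_induct)
    case (less a)
    show ?case
    proof (cases "\<Delta> \<preceq> a")
      case False then show ?thesis using less.prems by blast
    next
      case True
      then obtain c where c: "c \<in> P" "a = \<Delta> \<otimes> c" using less.prems by (auto simp: le_iff)
      define c' where "c' = Delta_conj (- 1) c"
      have c': "c' \<in> P" "a = c' \<otimes> \<Delta>" using c Delta_pow_mult[of c 1] by (auto simp: c'_def)
      have "norm c' < norm a" using norm_strict_mono(1)[OF c'(1) Delta_P assms(2)] c' by simp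
      then obtain b m where "b \<in> P" "\<not> \<Delta> \<preceq> b" "c' \<otimes> \<Delta> [^] (1 + n) = b \<otimes> \<Delta> [^] (m :: int)"
        using less.hyps[of c' "1 + n"] c' by blast
      moreover have "c' \<otimes> \<Delta> [^] (1 + n) = a \<otimes> \<Delta> [^] n"
        using c' by (simp add: int_pow_mult m_assoc)
      ultimately show ?thesis by auto
    qed
  qed
  then show ?thesis using that ex_positive_Delta_pow[OF assms(1)] by metis
qed

lemma Delta_coset_eq:
  "g \<in> carrier G \<Longrightarrow> Delta_coset G \<Delta> g = range (\<lambda>k::int. g \<otimes> \<Delta> [^] k)"
  unfolding Delta_coset_def l_coset_def generate_pow[OF P_carrier[OF Delta_P]] by blast

lemma Delta_coset_mult_pow:
  assumes "g \<in> carrier G"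
  shows "Delta_coset G \<Delta> (g \<otimes> \<Delta> [^] (n :: int)) = Delta_coset G \<Delta> g"
proof -
  have "g \<otimes> \<Delta> [^] n \<otimes> \<Delta> [^] k = g \<otimes> \<Delta> [^] (n + k)" for k :: int
    using assms by (simp add: m_assoc int_pow_mult)
  then have "Delta_coset G \<Delta> (g \<otimes> \<Delta> [^] n) = range (\<lambda>k::int. g \<otimes> \<Delta> [^] (n + k))"
    using assms by (simp add: Delta_coset_eq)
  also have "\<dots> = (\<lambda>k. g \<otimes> \<Delta> [^] k) ` range (\<lambda>k::int. n + k)"
    by (simp only: image_image)
  finally show ?thesis using assms by (simp add: Delta_coset_eq)
qed

lemma coset_rep_eq:
  assumes "a \<in> P" "\<not> \<Delta> \<preceq> a"
  shows "coset_rep G P \<Delta> (Delta_coset G \<Delta> a) = a"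
  unfolding coset_rep_def
proof (rule the_equality)
  show "a \<in> Delta_coset G \<Delta> a \<and> a \<in> P \<and> \<not> \<Delta> \<preceq> a"
    using assms by (auto simp: Delta_coset_eq intro!: range_eqI[of _ _ "0 :: int"])
  fix b assume b: "b \<in> Delta_coset G \<Delta> a \<and> b \<in> P \<and> \<not> \<Delta> \<preceq> b"
  then obtain k :: int where "b = a \<otimes> \<Delta> [^] k" using assms by (auto simp: Delta_coset_eq)
  then have "b \<otimes> \<Delta> [^] (0 :: int) = a \<otimes> \<Delta> [^] k" using b by simp
  then show "b = a" using Delta_free_unique b assms by blast
qed

lemma coset_rep_Delta_coset:
  assumes "g \<in> carrier G" "\<Delta> \<noteq> \<one>"
  obtains n :: int where
    "coset_rep G P \<Delta> (Delta_coset G \<Delta> g) \<in> P"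
    "g = coset_rep G P \<Delta> (Delta_coset G \<Delta> g) \<otimes> \<Delta> [^] n"
proof -
  obtain a n where a: "a \<in> P" "\<not> \<Delta> \<preceq> a" "g = a \<otimes> \<Delta> [^] (n :: int)"
    using ex_Delta_free assms by blast
  have "coset_rep G P \<Delta> (Delta_coset G \<Delta> g) = a"
    using a by (simp add: Delta_coset_mult_pow coset_rep_eq)
  then show ?thesis using a that by blast
qed

lemma Delta_coset_coset_rep:
  assumes "V \<in> coset_vertices G \<Delta>" "\<Delta> \<noteq> \<one>"
  shows "coset_rep G P \<Delta> V \<in> P" "Delta_coset G \<Delta> (coset_rep G P \<Delta> V) = V"
proof -
  obtain g where g: "g \<in> carrier G" "V = Delta_coset G \<Delta> g"
    using assms by (auto simp: coset_vertices_def)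
  obtain n :: int where n: "coset_rep G P \<Delta> V \<in> P" "g = coset_rep G P \<Delta> V \<otimes> \<Delta> [^] n"
    using coset_rep_Delta_coset g assms by blast
  then show "coset_rep G P \<Delta> V \<in> P" by simp
  show "Delta_coset G \<Delta> (coset_rep G P \<Delta> V) = V"
    using Delta_coset_mult_pow[OF P_carrier[OF n(1)], of n, folded n(2), folded g(2)]
    by (rule sym)
qed

lemma coset_dist_eq_norm:
  assumes "\<Delta> \<noteq> \<one>" "a \<in> P" "\<not> \<Delta> \<preceq> a"
    and "inv (coset_rep G P \<Delta> U) \<otimes> coset_rep G P \<Delta> V = a \<otimes> \<Delta> [^] (n :: int)"
  shows "coset_dist G P \<Delta> U V = norm a"
proof -
  obtain xs where "nf (a \<otimes> \<Delta> [^] n) xs n" "mprod G xs = a" using ex_nf assms by blast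
  then show ?thesis using assms by (simp add: coset_dist_def deligne_word_eq)
qed

text \<open>
  Here \<open>a\<close>, \<open>b\<close> and \<open>z\<close> are the positive elements describing \<open>V\<close>, \<open>W\<close> and \<open>p\<close> as seen from \<open>U\<close>. The three
  distances are their norms, and \<open>z\<close> is a proper left divisor of \<open>a\<close> or of \<open>b\<close>.
\<close>

lemma dist_geodesic_less:
  assumes ne: "\<Delta> \<noteq> \<one>"
    and V: "U \<in> coset_vertices G \<Delta>" "V \<in> coset_vertices G \<Delta>" "W \<in> coset_vertices G \<Delta>"
    and p: "p \<in> set (geodesic G P \<Delta> V W)" "V \<noteq> p" "p \<noteq> W"
  shows "coset_dist G P \<Delta> U p < max (coset_dist G P \<Delta> U V) (coset_dist G P \<Delta> U W)"
proof -
  define u where "u = coset_rep G P \<Delta> U"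
  define v where "v = coset_rep G P \<Delta> V"
  define w where "w = coset_rep G P \<Delta> W"
  have uvw: "u \<in> P" "v \<in> P" "w \<in> P" "Delta_coset G \<Delta> v = V" "Delta_coset G \<Delta> w = W"
    using V ne Delta_coset_coset_rep by (simp_all add: u_def v_def w_def)
  obtain a k where a: "a \<in> P" "\<not> \<Delta> \<preceq> a" "inv u \<otimes> v = a \<otimes> \<Delta> [^] (k :: int)"
    using ex_Delta_free[of "inv u \<otimes> v"] uvw ne by auto
  obtain b l where b: "b \<in> P" "\<not> \<Delta> \<preceq> b" "inv u \<otimes> w = b \<otimes> \<Delta> [^] (l :: int)"
    using ex_Delta_free[of "inv u \<otimes> w"] uvw ne by auto
  have v: "v = u \<otimes> (a \<otimes> \<Delta> [^] k)" using uvw a(1) a(3)[symmetric] by simp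
  have w: "w = u \<otimes> (b \<otimes> \<Delta> [^] l)" using uvw b(1) b(3)[symmetric] by simp
  obtain ms n where ms: "nf (inv a \<otimes> b) ms n"
    and path: "\<And>i. \<exists>j::int. \<exists>z\<in>P. (z \<preceq> a \<or> z \<preceq> b) \<and> a \<otimes> mprod G (take i ms) = z \<otimes> \<Delta> [^] j"
    using nf_fraction[OF ne a(1) b(1) a(2) b(2)] by blast
  have "inv v \<otimes> w = \<Delta> [^] (- k) \<otimes> (inv a \<otimes> b \<otimes> \<Delta> [^] l)"
    using a b uvw(1) unfolding v w by (simp add: inv_mult_group m_assoc int_pow_neg)
  then have word: "deligne_word G P \<Delta> (inv v \<otimes> w) = map (Delta_conj k) ms"
    using nf_Delta_pow[OF ms ne] deligne_word_eq ne by metis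
  obtain i where i: "p = Delta_coset G \<Delta> (v \<otimes> mprod G (take i (map (Delta_conj k) ms)))"
    using p(1) word unfolding geodesic_def Let_def v_def[symmetric] w_def[symmetric] set_map
    by (elim imageE) (simp only:)
  obtain j z where z: "z \<in> P" "z \<preceq> a \<or> z \<preceq> b" "a \<otimes> mprod G (take i ms) = z \<otimes> \<Delta> [^] (j :: int)"
    using path by blast
  let ?m = "mprod G (take i ms)"
  have sub: "set (take i ms) \<subseteq> P"
    using ms greedy_P set_take_subset by (fastforce simp: is_deligne_nf_def)
  then have m: "?m \<in> P" by simp
  \<comment> \<open>The twist of the word cancels against the power of \<open>\<Delta>\<close> by which \<open>v\<close> differs from \<open>u a\<close>.\<close>
  have "v \<otimes> mprod G (take i (map (Delta_conj k) ms)) = u \<otimes> (a \<otimes> (\<Delta> [^] k \<otimes> Delta_conj k ?m))"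
    using sub m a uvw(1) by (simp add: take_map Delta_conj_mprod v m_assoc)
  also have "\<dots> = u \<otimes> (a \<otimes> ?m \<otimes> \<Delta> [^] k)"
    using m a by (simp add: mult_Delta_pow[symmetric] m_assoc)
  also have "\<dots> = u \<otimes> z \<otimes> \<Delta> [^] (j + k)"
    using z uvw(1) by (simp add: m_assoc int_pow_mult)
  finally have pz: "p = Delta_coset G \<Delta> (u \<otimes> z)"
    using i z uvw(1) by (simp add: Delta_coset_mult_pow)
  have uz: "u \<otimes> z \<in> carrier G" using uvw(1) z(1) by simp
  obtain r :: int where r: "coset_rep G P \<Delta> p \<in> P" "u \<otimes> z = coset_rep G P \<Delta> p \<otimes> \<Delta> [^] r"
    by (rule coset_rep_Delta_coset[OF uz ne, folded pz])
  have "coset_rep G P \<Delta> p = u \<otimes> z \<otimes> \<Delta> [^] (- r)"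
    unfolding r(2) using r(1) by (simp add: m_assoc int_pow_neg)
  then have pr: "inv u \<otimes> coset_rep G P \<Delta> p = z \<otimes> \<Delta> [^] (- r)"
    using uvw(1) z(1) by (simp add: m_assoc)
  have free: "\<not> \<Delta> \<preceq> z"
    using z(1,2) a(1,2) b(1,2) le_trans[of \<Delta> z a] le_trans[of \<Delta> z b] by auto
  have dp: "coset_dist G P \<Delta> U p = norm z"
    by (rule coset_dist_eq_norm[OF ne z(1) free pr[unfolded u_def]])
  have dv: "coset_dist G P \<Delta> U V = norm a"
    by (rule coset_dist_eq_norm[OF ne a[unfolded u_def v_def]])
  have dw: "coset_dist G P \<Delta> U W = norm b"
    by (rule coset_dist_eq_norm[OF ne b[unfolded u_def w_def]])
  have "Delta_coset G \<Delta> (u \<otimes> a) = V"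
    using Delta_coset_mult_pow[of "u \<otimes> a" k] uvw(1,4) a(1) v by (simp add: m_assoc)
  moreover have "Delta_coset G \<Delta> (u \<otimes> b) = W"
    using Delta_coset_mult_pow[of "u \<otimes> b" l] uvw(1,5) b(1) w by (simp add: m_assoc)
  ultimately have "z \<noteq> a" "z \<noteq> b" using p(2,3) pz by auto
  then show ?thesis using norm_less z a(1) b(1) by (auto simp: dp dv dw less_max_iff_disj)
qed

end

lemma vertices_coset_complex: "vertices (coset_complex G P \<Delta>) = coset_vertices G \<Delta>"
  unfolding vertices_def coset_complex_def flag_complex_def by simp

theorem corollary6p5:
  fixes G :: "('a, 'b) monoid_scheme" and P :: "'a set" and \<Delta> :: 'a
    and u v w p :: "'a set"
  assumes "garside_group G P \<Delta>"
    and "\<Delta> \<noteq> \<one>\<^bsub>G\<^esub>"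
    and "v \<in> vertices (coset_complex G P \<Delta>)"
    and "w \<in> vertices (coset_complex G P \<Delta>)"
    and "p \<in> set (geodesic G P \<Delta> v w)"
    and "v \<noteq> p" and "p \<noteq> w"
    and "u \<in> vertices (coset_complex G P \<Delta>)"
  shows "coset_dist G P \<Delta> u p < max (coset_dist G P \<Delta> u v) (coset_dist G P \<Delta> u w)"
  by (rule garside_group.dist_geodesic_less[OF assms(1,2)
        assms(8,3,4)[unfolded vertices_coset_complex] assms(5-7)])

end
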